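(* Let $\ell\in\mathbb{Z}_{\ge2}$, let $b_{n,m}=b_{n,m}(\ell)$ be as in the context, and let $b_n=\sum_{m\ge0}b_{n,m}$. Put $a_n^a=\sqrt{2/\pi}\cdot n^{-1/2}\cdot 2^n$ and $$b_n^a=\begin{cases}\tfrac{\ell+1}{2\ell}\cdot a_n^a & \ell\text{ odd},\\ \tfrac{\ell+1+(-1)^{n+1}}{2\ell}\cdot a_n^a & \ell\text{ even}.\end{cases}$$ Then $b_n\sim b_n^a$ as $n\to\infty$, and $|b_n-b_n^a|/(n^{-1/2}\cdot 2^n)\in O(1/n)$.
   Context: For $n,m\in\mathbb{Z}_{\ge 0}$, $a_{n,m}$ is the number of unit step paths $(x_0,\dots,x_n)$ on $\mathbb{Z}_{\ge0}$ (integers $x_i\ge0$, $|x_i-x_{i-1}|=1$) with $x_0=0$, $x_n=m$. For fixed $\ell\in\mathbb{Z}_{\ge2}$, $b_{n,m}=b_{n,m}(\ell)$ is defined by: $b_{n,m}=a_{n,m}$ if $m\equiv-1\pmod\ell$; $b_{n,m}=b_{n-1,m-1}+b_{n-1,m+1}$ if $m\equiv m_0\pmod\ell$ with $0\le m_0<\ell-2$; $b_{n,m}=b_{n-1,m-1}$ if $m\equiv-2\pmod\ell$; the recursion is used for $n\ge1$ with $b_{0,0}=1$, $b_{0,m}=0$ for $m>0$, and $b_{n,-1}=0$. $\sim$ denotes asymptotic equality. *)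

theory Defs
  imports Complex_Main "HOL-Library.Landau_Symbols" "HOL-Analysis.Infinite_Sum"
begin

definition step_paths :: "nat \<Rightarrow> nat \<Rightarrow> nat list set" where
  "step_paths n m = {xs. length xs = Suc n \<and> xs ! 0 = 0 \<and> xs ! n = m \<and>
     (\<forall>i<n. xs ! Suc i = xs ! i + 1 \<or> xs ! i = xs ! Suc i + 1)}"

definition a_nm :: "nat \<Rightarrow> nat \<Rightarrow> nat" where
  "a_nm n m = card (step_paths n m)"

text \<open>b_{n,m}(l); the value b_{n,-1} = 0 is realised by the guard m = 0.
  Residues: m mod l = l-1 means m = -1 (mod l), m mod l = l-2 means m = -2 (mod l).\<close>
fun b_nm :: "nat \<Rightarrow> nat \<Rightarrow> nat \<Rightarrow> nat" where
  "b_nm l 0 m = (if m = 0 then 1 else 0)"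
| "b_nm l (Suc n) m =
     (if m mod l = l - 1 then a_nm (Suc n) m
      else if m mod l < l - 2 then
        (if m = 0 then 0 else b_nm l n (m - 1)) + b_nm l n (m + 1)
      else (if m = 0 then 0 else b_nm l n (m - 1)))"

definition b_n :: "nat \<Rightarrow> nat \<Rightarrow> real" where
  "b_n l n = infsum (\<lambda>m. real (b_nm l n m)) UNIV"

definition a_asym :: "nat \<Rightarrow> real" where
  "a_asym n = sqrt (2 / pi) * real n powr (-1/2) * 2 ^ n"

definition b_asym :: "nat \<Rightarrow> nat \<Rightarrow> real" where
  "b_asym l n = (if odd l then (real l + 1) / (2 * real l) * a_asym n
                 else (real l + 1 + (-1) ^ (n + 1)) / (2 * real l) * a_asym n)"

end

theory Submission
  imports Defs "HOL-Analysis.Gamma_Function" "HOL-Real_Asymp.Real_Asymp"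
begin

text \<open>
  Put M = m + 1. If m' is the mirror image of m in the next wall above, then
  b_{n,m} + b_{n,m'} = a_{n,m}. Hence b_n is the sum of those a_{n,m} for which M lies in
  {0,...,l} modulo 2l. Expanding this periodic condition in characters reduces b_n to the sums
  S_n(z) = (\<Sum>m. a_{n,m} z^(m+1)) with z^(2l) = 1, which satisfy
  S_{n+1}(z) = (z + 1/z) S_n(z) - a_{n,0}. As a_{n,0} = O(2^n n^(-3/2)) and |z + 1/z| < 2 for
  z \<noteq> 1, -1, only z = 1 and z = -1 contribute to the leading term. They give multiples of the
  central binomial coefficient, which Wallis' product bounds from both sides with relative
  error O(1/n).
\<close>

section \<open>Path counts and their last-step recursion\<close>

lemma step_paths_0: "step_paths 0 m = (if m = 0 then {[0]} else {})"
  by (auto simp: step_paths_def length_Suc_conv)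

text \<open>Splitting off the last vertex leaves a path ending at a neighbour of m; for m = 0 only
  the upper neighbour exists.\<close>

lemma step_paths_Suc:
  "step_paths (Suc n) m =
     (\<lambda>xs. xs @ [m]) ` ((if m = 0 then {} else step_paths n (m - 1)) \<union> step_paths n (m + 1))"
    (is "?L = ?R")
proof (intro equalityI subsetI)
  fix xs assume "xs \<in> ?L"
  then have len: "length xs = Suc (Suc n)" and x0: "xs ! 0 = 0" and xn: "xs ! Suc n = m"
    and st: "\<And>i. i \<le> n \<Longrightarrow> xs ! Suc i = xs ! i + 1 \<or> xs ! i = xs ! Suc i + 1"
    by (auto simp: step_paths_def less_Suc_eq_le)
  from len have "xs \<noteq> []" by auto
  define ys where "ys = butlast xs"
  have ys: "length ys = Suc n" "\<And>i. i \<le> n \<Longrightarrow> ys ! i = xs ! i"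
    using len by (auto simp: ys_def nth_butlast)
  have "last xs = m" using xn len \<open>xs \<noteq> []\<close> by (simp add: last_conv_nth)
  then have xs: "xs = ys @ [m]" using \<open>xs \<noteq> []\<close> unfolding ys_def by auto
  have "ys \<in> step_paths n (ys ! n)"
    using ys x0 st by (auto simp: step_paths_def less_Suc_eq_le)
  moreover have "m = ys ! n + 1 \<or> ys ! n = m + 1" using st[of n] ys xn by simp
  ultimately show "xs \<in> ?R" unfolding xs by auto
next
  fix xs assume "xs \<in> ?R"
  then obtain ys k where xs: "xs = ys @ [m]" and ys: "ys \<in> step_paths n k"
    and k: "m = k + 1 \<or> k = m + 1"
    by (auto split: if_splits)
  then show "xs \<in> ?L"
    by (auto simp: step_paths_def nth_append less_Suc_eq)
qed

lemma finite_step_paths: "finite (step_paths n m)"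
  by (induction n arbitrary: m) (auto simp: step_paths_0 step_paths_Suc)

lemma a_nm_0: "a_nm 0 m = (if m = 0 then 1 else 0)"
  by (simp add: a_nm_def step_paths_0)

lemma a_nm_Suc: "a_nm (Suc n) m = (if m = 0 then 0 else a_nm n (m - 1)) + a_nm n (m + 1)"
proof -
  have inj: "inj_on (\<lambda>xs. xs @ [m]) A" for A by (auto intro: inj_onI)
  have "step_paths n (m - 1) \<inter> step_paths n (m + 1) = {}"
    by (auto simp: step_paths_def)
  then show ?thesis unfolding a_nm_def step_paths_Suc card_image[OF inj]
    by (auto simp: card_Un_disjoint finite_step_paths)
qed

lemma a_nm_eq_0: "n < m \<Longrightarrow> a_nm n m = 0"
  by (induction n arbitrary: m) (auto simp: a_nm_0 a_nm_Suc)

lemma a_nm_odd: "odd (n + m) \<Longrightarrow> a_nm n m = 0"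
  by (induction n arbitrary: m) (auto simp: a_nm_0 a_nm_Suc odd_pos)

lemma b_nm_eq_0: "n < m \<Longrightarrow> b_nm l n m = 0"
  by (induction n arbitrary: m) (auto simp: a_nm_eq_0)

section \<open>Reflection in the walls\<close>

text \<open>
  Shifting the index by one puts the walls at the multiples of l; the value 0 at 0
  absorbs the boundary case b_{n,-1} = 0 of the recursion.
\<close>

definition shift :: "(nat \<Rightarrow> nat) \<Rightarrow> nat \<Rightarrow> nat" where
  "shift f M = (if M = 0 then 0 else f (M - 1))"

lemma shift_0 [simp]: "shift f 0 = 0" and shift_Suc [simp]: "shift f (Suc m) = f m"
  by (simp_all add: shift_def)

lemma shift_a_Suc:
  assumes "M > 0"
  shows "shift (a_nm (Suc n)) M = shift (a_nm n) (M - 1) + shift (a_nm n) (M + 1)"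
  using assms by (cases M) (auto simp: a_nm_Suc shift_def)

text \<open>Carries the case distinction of \<open>b_nm\<close> over to M = m + 1: the walls get
  residue 0, and the points that receive nothing from above get residue l - 1.\<close>

lemma mod_Suc_pred:
  fixes l m :: nat
  assumes "l \<ge> 2"
  shows "m mod l = l - 1 \<longleftrightarrow> Suc m mod l = 0"
    and "m mod l < l - 2 \<longleftrightarrow> Suc m mod l \<noteq> 0 \<and> Suc m mod l \<noteq> l - 1"
proof -
  have x: "x = l - 1 \<longleftrightarrow> (if Suc x = l then 0 else Suc x) = 0"
      "x < l - 2 \<longleftrightarrow> (if Suc x = l then 0 else Suc x) \<noteq> 0 \<and> (if Suc x = l then 0 else Suc x) \<noteq> l - 1"
    if "x < l" for x
    using that assms by auto
  have "m mod l < l" using assms by simp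
  from x[OF this]
  show "m mod l = l - 1 \<longleftrightarrow> Suc m mod l = 0"
    and "m mod l < l - 2 \<longleftrightarrow> Suc m mod l \<noteq> 0 \<and> Suc m mod l \<noteq> l - 1"
    unfolding mod_Suc .
qed

lemma shift_b_wall:
  assumes "l \<ge> 2" "l dvd M"
  shows "shift (b_nm l n) M = shift (a_nm n) M"
  using assms mod_Suc_pred(1)[of l]
  by (cases n; cases M) (auto simp: a_nm_0 dvd_eq_mod_eq_0)

lemma shift_b_Suc:
  assumes "l \<ge> 2" "M mod l \<noteq> 0"
  shows "shift (b_nm l (Suc n)) M =
    shift (b_nm l n) (M - 1) + (if M mod l = l - 1 then 0 else shift (b_nm l n) (M + 1))"
  using assms mod_Suc_pred[of l] by (cases M) (auto simp: shift_def)

text \<open>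
  For 0 < r < l the point (k + 2) l - r is the mirror image of k l + r in the wall (k + 1) l.
  On both walls next to k l + r the two contributions of the recursion complement each other.
\<close>

lemma b_reflection:
  assumes "l \<ge> 2" "0 < r" "r < l"
  shows "shift (b_nm l n) (k * l + r) + shift (b_nm l n) ((k + 2) * l - r) = shift (a_nm n) (k * l + r)"
  using assms(2,3)
proof (induction n arbitrary: r)
  case 0
  \<comment> \<open>The mirror image lies above (k + 1) l >= 2, hence never at the shifted starting
    point 1.\<close>
  have "(k + 2) * l - r \<noteq> 1" "(k + 2) * l - r \<noteq> 0" using 0 by (auto simp: algebra_simps)
  then show ?case by (auto simp: shift_def a_nm_0)
next
  case (Suc n)
  let ?B = "shift (b_nm l n)" and ?A = "shift (a_nm n)"
  define M where "M = k * l + r"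
  define M' where "M' = (k + 2) * l - r"
  have M': "M' = (k + 1) * l + (l - r)" using Suc.prems by (simp add: M'_def algebra_simps)
  have r: "M mod l = r" "M' mod l = l - r"
    using Suc.prems unfolding M_def M' mod_mult_self3 by simp_all
  have B: "shift (b_nm l (Suc n)) M = ?B (M - 1) + (if r = l - 1 then 0 else ?B (M + 1))"
    using shift_b_Suc[OF assms(1), of M n] r Suc.prems by simp
  have B': "shift (b_nm l (Suc n)) M' = ?B (M' - 1) + (if r = 1 then 0 else ?B (M' + 1))"
    using shift_b_Suc[OF assms(1), of M' n] r Suc.prems assms(1) by (auto simp: diff_eq_diff_eq)
  have A: "shift (a_nm (Suc n)) M = ?A (M - 1) + ?A (M + 1)"
    using shift_a_Suc[of M n] Suc.prems by (simp add: M_def)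
  \<comment> \<open>M - 1 and M' + 1 lie farther from the middle wall and are again mirror images.
    For r = 1 the first is the wall k l, where b equals a, and the recursion at M' omits the
    second.\<close>
  have lo: "?B (M - 1) + (if r = 1 then 0 else ?B (M' + 1)) = ?A (M - 1)"
  proof (cases "r = 1")
    case True
    then show ?thesis using shift_b_wall[OF assms(1), of "M - 1" n] by (simp add: M_def)
  next
    case False
    then have "M - 1 = k * l + (r - 1)" "M' + 1 = (k + 2) * l - (r - 1)"
      using Suc.prems by (auto simp: M_def M'_def algebra_simps)
    then show ?thesis using Suc.IH[of "r - 1"] False Suc.prems by simp
  qed
  \<comment> \<open>M + 1 and M' - 1 lie nearer to the middle wall. For r = l - 1 both coincide with
    it, but only M' receives a contribution from there, so the wall value is counted once.\<close>
  have hi: "?B (M' - 1) + (if r = l - 1 then 0 else ?B (M + 1)) = ?A (M + 1)"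
  proof (cases "r = l - 1")
    case True
    then have "M + 1 = (k + 1) * l" "M' - 1 = (k + 1) * l"
      using Suc.prems by (auto simp: M_def M' algebra_simps)
    then show ?thesis using shift_b_wall[OF assms(1), of "(k + 1) * l" n] True by simp
  next
    case False
    then have "M + 1 = k * l + (r + 1)" "M' - 1 = (k + 2) * l - (r + 1)"
      using Suc.prems by (auto simp: M_def M'_def algebra_simps)
    moreover have "?B (k * l + (r + 1)) + ?B ((k + 2) * l - (r + 1)) = ?A (k * l + (r + 1))"
      using Suc.IH[of "r + 1"] False Suc.prems by linarith
    ultimately show ?thesis using False by simp
  qed
  show ?case unfolding M_def[symmetric] M'_def[symmetric] A B B' lo[symmetric] hi[symmetric]
    by (simp only: ac_simps)
qed

section \<open>From b to path counts over a set of residues modulo 2l\<close>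

lemma sum_reflect:
  fixes f :: "nat \<Rightarrow> nat"
  assumes "0 < l"
  shows "(\<Sum>s<2 * l. f s) = f 0 + f l + (\<Sum>s\<in>{0<..<l}. f s + f (2 * l - s))"
proof -
  have "{..<2 * l} = {0, l} \<union> ({0<..<l} \<union> {l<..<2 * l})" using assms by auto
  then have "sum f {..<2 * l} = f 0 + f l + (sum f {0<..<l} + sum f {l<..<2 * l})"
    using assms by (simp only:) (subst sum.union_disjoint; auto simp: sum.union_disjoint)
  also have "sum f {l<..<2 * l} = (\<Sum>s\<in>{0<..<l}. f (2 * l - s))"
    by (rule sum.reindex_bij_witness[of _ "\<lambda>s. 2 * l - s" "\<lambda>s. 2 * l - s"]) auto
  finally show ?thesis by (simp add: sum.distrib)
qed

text \<open>In a block of length 2l starting at an even multiple of l, the middle wall pairs s with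
  2l - s. By \<open>b_reflection\<close> each pair sums to the value of a at its lower member; the
  two walls contribute their own a.\<close>

lemma block_sum:
  assumes "l \<ge> 2"
  shows "(\<Sum>s<2 * l. shift (b_nm l n) (q * (2 * l) + s)) =
         (\<Sum>s<2 * l. if s \<le> l then shift (a_nm n) (q * (2 * l) + s) else 0)"
proof -
  let ?B = "shift (b_nm l n)" and ?A = "shift (a_nm n)"
  have "?B (q * (2 * l) + s) + ?B (q * (2 * l) + (2 * l - s)) = ?A (q * (2 * l) + s)"
    if "s \<in> {0<..<l}" for s
  proof -
    have "q * (2 * l) + (2 * l - s) = (2 * q + 2) * l - s" using that by (simp add: algebra_simps)
    then show ?thesis using b_reflection[OF assms, of s n "2 * q"] that by (simp add: mult.assoc mult.left_commute)
  qed
  moreover have "?B (q * (2 * l)) = ?A (q * (2 * l))" "?B (q * (2 * l) + l) = ?A (q * (2 * l) + l)"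
    using shift_b_wall[OF assms, of _ n] by simp_all
  ultimately show ?thesis using assms
    by (auto simp: sum_reflect intro!: sum.cong)
qed

lemma sum_b_eq:
  assumes "l \<ge> 2"
  shows "(\<Sum>m\<le>n. b_nm l n m) = (\<Sum>m\<le>n. if Suc m mod (2 * l) \<le> l then a_nm n m else 0)"
proof -
  let ?B = "shift (b_nm l n)" and ?A = "\<lambda>M. if M mod (2 * l) \<le> l then shift (a_nm n) M else 0"
  \<comment> \<open>A whole number of blocks of length 2l that reaches beyond n + 1, the largest
    shifted index with a nonzero value.\<close>
  define N where "N = Suc (Suc n) * (2 * l)"
  have N: "Suc (Suc n) \<le> N" using mult_le_mono[of "Suc (Suc n)" "Suc (Suc n)" 1 "2 * l"] assms by (simp add: N_def)
  have *: "(\<Sum>m\<le>n. f (Suc m)) = sum f {..<N}" if "f 0 = 0" "\<And>M. n < M - 1 \<Longrightarrow> f M = 0" for f :: "nat \<Rightarrow> nat"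
  proof -
    have "sum f {..<N} = sum f {..<Suc (Suc n)}"
      using N that by (intro sum.mono_neutral_right) auto
    also have "\<dots> = f 0 + (\<Sum>m\<le>n. f (Suc m))" by (subst sum.lessThan_Suc_shift) (simp add: lessThan_Suc_atMost)
    finally show ?thesis using that by simp
  qed
  have blk: "sum f {q * (2 * l)..<q * (2 * l) + 2 * l} = (\<Sum>s<2 * l. f (q * (2 * l) + s))" for f :: "nat \<Rightarrow> nat" and q
    using sum.shift_bounds_nat_ivl[of f 0 "q * (2 * l)" "2 * l"] by (simp add: atLeast0LessThan add.commute)
  have "(\<Sum>m\<le>n. b_nm l n m) = sum ?B {..<N}"
    using *[of ?B] b_nm_eq_0 by (simp add: shift_def)
  also have "\<dots> = (\<Sum>q<Suc (Suc n). \<Sum>s<2 * l. ?B (q * (2 * l) + s))"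
    unfolding N_def sum.nat_group[symmetric] blk ..
  also have "\<dots> = (\<Sum>q<Suc (Suc n). \<Sum>s<2 * l. ?A (q * (2 * l) + s))"
    unfolding block_sum[OF assms] by (intro sum.cong) auto
  also have "\<dots> = sum ?A {..<N}"
    unfolding N_def sum.nat_group[symmetric] blk ..
  also have "\<dots> = (\<Sum>m\<le>n. ?A (Suc m))"
    by (rule *[symmetric]) (simp_all add: shift_def a_nm_eq_0)
  finally show ?thesis by (simp cong: if_cong)
qed

lemma b_n_eq:
  assumes "l \<ge> 2"
  shows "b_n l n = (\<Sum>m\<le>n. if Suc m mod (2 * l) \<le> l then real (a_nm n m) else 0)"
proof -
  have "b_n l n = infsum (\<lambda>m. real (b_nm l n m)) {..n}"
    unfolding b_n_def by (rule infsum_cong_neutral) (auto simp: b_nm_eq_0)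
  also have "\<dots> = real (\<Sum>m\<le>n. b_nm l n m)" by simp
  also have "\<dots> = (\<Sum>m\<le>n. if Suc m mod (2 * l) \<le> l then real (a_nm n m) else 0)"
    unfolding sum_b_eq[OF assms] of_nat_sum by (intro sum.cong) auto
  finally show ?thesis .
qed

section \<open>The generating sums S_n(z)\<close>

definition path_sum :: "nat \<Rightarrow> complex \<Rightarrow> complex" where
  "path_sum n z = (\<Sum>m\<le>n. of_nat (a_nm n m) * z ^ Suc m)"

text \<open>A step up multiplies the weight by z and a step down by \<open>inverse z\<close>. The
  forbidden step down from height 0 would have weight z * \<open>inverse z\<close> = 1, so it is
  subtracted once for each path ending at 0.\<close>

lemma path_sum_Suc:
  assumes "z \<noteq> 0"
  shows "path_sum (Suc n) z = (z + inverse z) * path_sum n z - of_nat (a_nm n 0)"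
proof -
  have "path_sum (Suc n) z = (\<Sum>m\<le>Suc n. of_nat (if m = 0 then 0 else a_nm n (m - 1)) * z ^ Suc m) +
      (\<Sum>m\<le>Suc n. of_nat (a_nm n (m + 1)) * z ^ Suc m)"
    unfolding path_sum_def by (simp only: a_nm_Suc of_nat_add distrib_right sum.distrib)
  also have "(\<Sum>m\<le>Suc n. of_nat (if m = 0 then 0 else a_nm n (m - 1)) * z ^ Suc m) = z * path_sum n z"
    unfolding path_sum_def by (subst sum.atMost_Suc_shift) (simp add: sum_distrib_left mult_ac)
  also have "(\<Sum>m\<le>Suc n. of_nat (a_nm n (m + 1)) * z ^ Suc m) = (\<Sum>m<n. of_nat (a_nm n (m + 1)) * z ^ Suc m)"
    by (rule sum.mono_neutral_right) (auto simp: a_nm_eq_0)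
  also have "\<dots> = inverse z * path_sum n z - of_nat (a_nm n 0)"
  proof -
    have "path_sum n z = of_nat (a_nm n 0) * z + (\<Sum>m<n. of_nat (a_nm n (Suc m)) * z ^ Suc (Suc m))"
      unfolding path_sum_def by (subst sum.atMost_shift) simp
    then show ?thesis using assms by (simp add: distrib_left sum_distrib_left field_simps)
  qed
  finally show ?thesis by (simp add: algebra_simps)
qed

text \<open>Only heights m of the same parity as n occur, so every exponent m + 1 that matters has
  the parity of n + 1.\<close>

lemma path_sum_minus: "path_sum n (- z) = (- 1) ^ Suc n * path_sum n z"
  unfolding path_sum_def sum_distrib_left
proof (intro sum.cong refl)
  fix m
  show "of_nat (a_nm n m) * (- z) ^ Suc m = (- 1) ^ Suc n * (of_nat (a_nm n m) * z ^ Suc m)"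
    using a_nm_odd[of n m] by (cases "odd (n + m)") (auto simp: power_minus[of z] minus_one_power_iff)
qed

section \<open>Ballot numbers, central binomial coefficients and Wallis' product\<close>

lemma central_binomial_sym: "Suc (2 * k) choose Suc k = Suc (2 * k) choose k"
  using binomial_symmetric[of k "Suc (2 * k)"] by (simp add: Suc_diff_le)

text \<open>The ballot formula, cleared of denominators; j counts the down-steps. For m > 0 the
  induction step multiplies by m + j so that both induction hypotheses apply, and then cancels this
  factor.\<close>

lemma a_nm_closed:
  "n = m + 2 * j \<Longrightarrow> (m + j + 1) * a_nm n m = (m + 1) * (n choose j)"
proof (induction n arbitrary: m j)
  case 0
  then show ?case by (simp add: a_nm_0)
next
  case (Suc n)
  show ?case
  proof (cases j)
    case 0
    then have m: "m = Suc n" using Suc.prems by simp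
    have "Suc n * a_nm n n = Suc n * 1" using Suc.IH[of n 0] by simp
    then have "a_nm n n = 1" unfolding mult_cancel1 by simp
    then show ?thesis by (simp add: m 0 a_nm_Suc a_nm_eq_0)
  next
    case j: (Suc i)
    have a2: "(m + j + 1) * a_nm n (m + 1) = (m + 2) * (n choose i)"
      using Suc.IH[of "m + 1" i] Suc.prems j by simp
    show ?thesis
    proof (cases m)
      case 0
      then have "n = Suc (2 * i)" using Suc.prems j by simp
      then show ?thesis using a2 central_binomial_sym[of i] by (simp add: 0 j a_nm_Suc)
    next
      case m: (Suc k)
      have a1: "(m + j) * a_nm n k = m * (n choose j)"
        using Suc.IH[of k j] Suc.prems m by simp
      have "n - i = m + j" using Suc.prems j by simp
      then have c: "(m + j) * (n choose i) = j * (n choose j)"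
        using binomial_absorb_comp[of n i] binomial_absorption[of i n] j by (cases n) (auto simp: Suc_times_binomial_eq)
      have "(m + j) * ((m + j + 1) * (a_nm n k + a_nm n (m + 1))) =
          (m + j + 1) * ((m + j) * a_nm n k) + (m + j) * ((m + j + 1) * a_nm n (m + 1))"
        by (simp add: algebra_simps)
      also have "\<dots> = (m + j + 1) * (m * (n choose j)) + (m + 2) * ((m + j) * (n choose i))"
        unfolding a1 a2 by (simp add: algebra_simps)
      also have "\<dots> = (m + 1) * ((m + j) * (n choose j) + (m + j) * (n choose i))"
        unfolding c by (simp add: algebra_simps)
      finally have "(m + j) * ((m + j + 1) * (a_nm n k + a_nm n (m + 1))) =
          (m + j) * ((m + 1) * ((n choose i) + (n choose j)))"
        by (simp add: algebra_simps)
      then have "(m + j + 1) * (a_nm n k + a_nm n (m + 1)) = (m + 1) * ((n choose i) + (n choose j))"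
        using j by (metis add_eq_0_iff_both_eq_0 mult_cancel1 nat.distinct(1))
      then show ?thesis by (simp add: a_nm_Suc j m)
    qed
  qed
qed

lemma a_nm_even_0: "real (a_nm (2 * k) 0) = real ((2 * k) choose k) / (real k + 1)"
proof -
  have "real ((k + 1) * a_nm (2 * k) 0) = real ((2 * k) choose k)"
    using a_nm_closed[of "2 * k" 0 k] by simp
  then show ?thesis by (simp add: field_simps)
qed

text \<open>The probability that a simple random walk on the integers is back at its start after 2k
  steps.\<close>

definition cb_ratio :: "nat \<Rightarrow> real" where
  "cb_ratio k = real ((2 * k) choose k) / 4 ^ k"

lemma cb_ratio_pos: "cb_ratio k > 0"
  by (simp add: cb_ratio_def)

lemma cb_ratio_Suc: "cb_ratio (Suc k) = cb_ratio k * (2 * real k + 1) / (2 * real k + 2)"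
proof -
  have "Suc k * ((2 * Suc k) choose Suc k) = 2 * (2 * k + 1) * ((2 * k) choose k)"
  proof -
    have 1: "Suc k * (Suc (Suc (2 * k)) choose Suc k) = Suc (Suc (2 * k)) * (Suc (2 * k) choose k)"
      by (rule Suc_times_binomial_eq[symmetric, simplified mult.commute])
    have "Suc (2 * k) choose k = Suc (2 * k) choose Suc k" by (rule central_binomial_sym[symmetric])
    moreover have "Suc k * (Suc (2 * k) choose Suc k) = Suc (2 * k) * (2 * k choose k)"
      by (rule Suc_times_binomial_eq[symmetric, simplified mult.commute])
    ultimately have 2: "Suc k * (Suc (2 * k) choose k) = Suc (2 * k) * (2 * k choose k)" by simp
    show ?thesis using 1 2 by (simp add: algebra_simps)
  qed
  from arg_cong[OF this, of real] have "real (Suc k) * real ((2 * Suc k) choose Suc k) = 2 * (2 * real k + 1) * real ((2 * k) choose k)"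
    by (simp only: of_nat_mult of_nat_add of_nat_1 of_nat_numeral)
  then have "real ((2 * Suc k) choose Suc k) = 2 * (2 * real k + 1) * real ((2 * k) choose k) / (real k + 1)"
    by (simp only: nonzero_eq_divide_eq of_nat_Suc) (simp add: ac_simps)
  moreover have "2 * a * y / b / (4 * p) = y / p * a / (2 * b)" for a y b p :: real by (simp add: mult_ac)
  moreover have "2 * (real k + 1) = 2 * real k + 2" by simp
  ultimately show ?thesis unfolding cb_ratio_def power_Suc by metis
qed

text \<open>Both sides are 1 at n = 0 and change by the same factor (2n + 1)(2n + 3) / (2n + 2)^2.
  The right side is the reciprocal of a partial Wallis product, which yields the limit 2/pi.\<close>

lemma cb_ratio_wallis:
  "cb_ratio n ^ 2 * (2 * real n + 1) = 1 / (\<Prod>k=1..n. (4*real k^2) / (4*real k^2 - 1))"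
proof (induction n)
  case (Suc n)
  have "4 * (real n + 1)^2 - 1 = (2 * real n + 1) * (2 * real n + 3)"
    by (simp add: power2_eq_square algebra_simps)
  moreover have "(2 * real n + 2)\<^sup>2 = 4 * (real n + 1)^2" by (simp add: power2_eq_square algebra_simps)
  ultimately have "cb_ratio (Suc n) ^ 2 * (2 * real (Suc n) + 1) =
      (cb_ratio n ^ 2 * (2 * real n + 1)) / ((4*real (Suc n)^2) / (4*real (Suc n)^2 - 1))"
    by (simp add: cb_ratio_Suc power_mult_distrib power_divide field_simps power2_eq_square)
  also have "\<dots> = 1 / (\<Prod>k=1..Suc n. (4*real k^2) / (4*real k^2 - 1))"
    unfolding Suc.IH by (subst prod.nat_ivl_Suc') (simp_all add: mult.commute)
  finally show ?case .
qed (simp add: cb_ratio_def)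

lemma cb_ratio_limit: "(\<lambda>n. cb_ratio n ^ 2 * (2 * real n + 1)) \<longlonglongrightarrow> 2 / pi"
  unfolding cb_ratio_wallis using tendsto_divide[OF tendsto_const[of 1] wallis] by simp

text \<open>The sequence decreases because (2n + 1)(2n + 3) <= (2n + 2)^2, so its limit is a lower
  bound.\<close>

lemma cb_ratio_lower: "2 / pi \<le> cb_ratio n ^ 2 * (2 * real n + 1)"
proof (rule decseq_ge[OF decseq_SucI cb_ratio_limit])
  fix n
  have "cb_ratio (Suc n) ^ 2 * (2 * real (Suc n) + 1) =
      cb_ratio n ^ 2 * (2 * real n + 1) * ((2 * real n + 1) * (2 * real n + 3) / (2 * real n + 2)^2)"
    by (simp add: cb_ratio_Suc power_mult_distrib power_divide power2_eq_square mult_ac)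
  also have "\<dots> \<le> cb_ratio n ^ 2 * (2 * real n + 1) * 1"
    by (intro mult_left_mono) (simp_all add: power2_eq_square divide_le_eq_1 algebra_simps add_pos_nonneg)
  finally show "cb_ratio (Suc n) ^ 2 * (2 * real (Suc n) + 1) \<le> cb_ratio n ^ 2 * (2 * real n + 1)" by simp
qed

lemma cb_ratio_limit': "(\<lambda>n. cb_ratio n ^ 2 * (2 * real n)) \<longlonglongrightarrow> 2 / pi"
proof -
  have "(\<lambda>n. cb_ratio n ^ 2 * (2 * real n + 1) * (2 * real n / (2 * real n + 1))) \<longlonglongrightarrow> 2 / pi * 1"
    by (intro tendsto_mult cb_ratio_limit) real_asymp
  moreover have "2 * real n + 1 \<noteq> 0" for n by linarith
  ultimately show ?thesis by simp
qed

text \<open>With the factor 2n in place of 2n + 1 the sequence increases, because 2n (2n + 2) <= (2n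
  + 1)^2, and the unchanged limit becomes an upper bound.\<close>

lemma cb_ratio_upper: "cb_ratio n ^ 2 * (2 * real n) \<le> 2 / pi"
proof (rule incseq_le[OF incseq_SucI cb_ratio_limit'])
  fix n
  have "2 * real n \<le> (2 * real n + 1)^2 / (2 * real n + 2)"
    by (simp add: power2_eq_square field_simps)
  then have "cb_ratio n ^ 2 * (2 * real n) \<le> cb_ratio n ^ 2 * ((2 * real n + 1)^2 / (2 * real n + 2))"
    by (rule mult_left_mono) simp
  also have "\<dots> = cb_ratio (Suc n) ^ 2 * (2 * real (Suc n))"
  proof -
    have "c\<^sup>2 * (x\<^sup>2 / p) = (c * x / p)\<^sup>2 * p" if "p \<noteq> 0" for c x p :: real
      using that by (simp add: power2_eq_square)
    from this[of "2 * real n + 2" "cb_ratio n" "2 * real n + 1"] show ?thesis by (simp add: cb_ratio_Suc add.commute)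
  qed
  finally show "cb_ratio n ^ 2 * (2 * real n) \<le> cb_ratio (Suc n) ^ 2 * (2 * real (Suc n))" .
qed

section \<open>Asymptotics of the total number of paths\<close>

text \<open>The probability that a simple random walk started at 0 stays nonnegative for n
  steps.\<close>

definition path_prob :: "nat \<Rightarrow> real" where
  "path_prob n = (\<Sum>m\<le>n. real (a_nm n m)) / 2 ^ n"

lemma path_sum_1: "path_sum n 1 = of_real (path_prob n * 2 ^ n)"
  by (simp add: path_sum_def path_prob_def)

lemma path_prob_0: "path_prob 0 = 1"
  by (simp add: path_prob_def a_nm_0)

text \<open>A path loses one of its two continuations exactly when it ends at 0; formally this is
  \<open>path_sum_Suc\<close> at z = 1.\<close>

lemma path_prob_Suc: "path_prob (Suc n) = path_prob n - real (a_nm n 0) / 2 ^ Suc n"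
proof -
  have "of_real (path_prob (Suc n) * 2 ^ Suc n) = (of_real (2 * (path_prob n * 2 ^ n) - real (a_nm n 0)) :: complex)"
    using path_sum_Suc[of 1 n] unfolding path_sum_1 by simp
  then have "path_prob (Suc n) * 2 ^ Suc n = 2 * (path_prob n * 2 ^ n) - real (a_nm n 0)"
    by (simp only: of_real_eq_iff)
  then show ?thesis by (simp add: field_simps)
qed

lemma a_nm_even_0_ratio: "real (a_nm (2 * k) 0) / 2 ^ (2 * k) = cb_ratio k / (real k + 1)"
  by (simp add: a_nm_even_0 cb_ratio_def power_mult)

text \<open>From time 2k to 2k + 1 the loss at 0 is the fraction 1 / (2k + 2), which is the
  recursion of \<open>cb_ratio\<close>. From 2k + 1 to 2k + 2 nothing is lost, since no path ends at
  0 at an odd time.\<close>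

lemma path_prob_cb_ratio: "path_prob (2 * k) = cb_ratio k \<and> path_prob (Suc (2 * k)) = cb_ratio (Suc k)"
proof -
  have odd: "path_prob (Suc (2 * k)) = cb_ratio (Suc k)" if "path_prob (2 * k) = cb_ratio k" for k
  proof -
    have "path_prob (Suc (2 * k)) = cb_ratio k - (cb_ratio k / (real k + 1)) / 2"
      unfolding path_prob_Suc that a_nm_even_0_ratio[symmetric] by simp
    then show ?thesis by (simp add: cb_ratio_Suc field_simps)
  qed
  have "path_prob (2 * k) = cb_ratio k"
  proof (induction k)
    case (Suc k)
    have "a_nm (Suc (2 * k)) 0 = 0" by (rule a_nm_odd) simp
    then show ?case using odd[OF Suc] path_prob_Suc[of "Suc (2 * k)"] by simp
  qed (simp add: path_prob_0 cb_ratio_def)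
  with odd show ?thesis by blast
qed

lemma path_prob_pos: "path_prob n > 0"
  using path_prob_cb_ratio[of "n div 2"] cb_ratio_pos by (cases "even n") (auto elim!: evenE oddE)

lemma path_prob_upper: "path_prob n ^ 2 * real n \<le> 2 / pi"
proof (cases "even n")
  case True
  then obtain k where "n = 2 * k" by (rule evenE)
  then show ?thesis using cb_ratio_upper[of k] path_prob_cb_ratio[of k] by simp
next
  case False
  then obtain k where n: "n = Suc (2 * k)" by (auto elim: oddE)
  have "cb_ratio (Suc k) ^ 2 * real n \<le> cb_ratio (Suc k) ^ 2 * (2 * real (Suc k))"
    by (intro mult_left_mono) (simp_all add: n)
  then show ?thesis using cb_ratio_upper[of "Suc k"] path_prob_cb_ratio[of k] n by simp
qed

text \<open>The shift by 2 covers both parities: for n = 2k + 1 the Wallis factor is 2 (k + 1) + 1 =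
  n + 2, and for even n it is only n + 1.\<close>

lemma path_prob_lower: "2 / pi \<le> path_prob n ^ 2 * (real n + 2)"
proof (cases "even n")
  case True
  then obtain k where n: "n = 2 * k" by (rule evenE)
  have "cb_ratio k ^ 2 * (2 * real k + 1) \<le> cb_ratio k ^ 2 * (real n + 2)"
    by (intro mult_left_mono) (simp_all add: n)
  then show ?thesis using cb_ratio_lower[of k] path_prob_cb_ratio[of k] n by simp
next
  case False
  then obtain k where n: "n = Suc (2 * k)" by (auto elim: oddE)
  then have "2 * real (Suc k) + 1 = real n + 2" by simp
  then show ?thesis using cb_ratio_lower[of "Suc k"] path_prob_cb_ratio[of k] n by simp
qed

text \<open>Up to the constant, \<open>path_prob\<close> lies between (n + 2)^(-1/2) and n^(-1/2),
  and these differ by O(n^(-3/2)).\<close>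

lemma path_prob_asymptotic: "(\<lambda>n. path_prob n - sqrt (2 / pi) * real n powr (-1/2)) \<in> O(\<lambda>n. real n powr (-3/2))"
proof -
  let ?c = "sqrt (2 / pi)"
  have hi: "path_prob n \<le> ?c * real n powr (-1/2)" and lo: "?c * (real n + 2) powr (-1/2) \<le> path_prob n"
    if "n > 0" for n
  proof -
    have p: "y powr (-1/2) = 1 / sqrt y" if "y > 0" for y :: real
      using that powr_minus[of y "1/2"] by (simp add: powr_half_sqrt field_simps)
    have "path_prob n ^ 2 \<le> (2 / pi) / real n" using path_prob_upper[of n] that by (simp add: pos_le_divide_eq mult_ac)
    then have "path_prob n \<le> sqrt ((2 / pi) / real n)" by (rule real_le_rsqrt)
    then show "path_prob n \<le> ?c * real n powr (-1/2)" using that p[of "real n"] by (simp add: real_sqrt_divide real_sqrt_mult)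
    have "(2 / pi) / (real n + 2) \<le> path_prob n ^ 2" using path_prob_lower[of n] by (simp add: pos_divide_le_eq mult_ac)
    then have "sqrt ((2 / pi) / (real n + 2)) \<le> path_prob n" using path_prob_pos[of n] by (simp add: real_le_lsqrt)
    then show "?c * (real n + 2) powr (-1/2) \<le> path_prob n" using p[of "real n + 2"] by (simp add: real_sqrt_divide real_sqrt_mult)
  qed
  have "(\<lambda>n. path_prob n - ?c * real n powr (-1/2)) \<in> O(\<lambda>n. ?c * (real n powr (-1/2) - (real n + 2) powr (-1/2)))"
  proof (rule bigoI[of _ 1], rule eventually_mono[OF eventually_gt_at_top[of 0]])
    fix n :: nat assume "n > 0"
    have "\<bar>w - x\<bar> \<le> \<bar>x - y\<bar>" if "w \<le> x" "y \<le> w" for w x y :: real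
      using that by linarith
    from this[OF hi lo, OF \<open>n > 0\<close> \<open>n > 0\<close>]
    show "norm (path_prob n - ?c * real n powr (-1/2)) \<le> 1 * norm (?c * (real n powr (-1/2) - (real n + 2) powr (-1/2)))"
      unfolding right_diff_distrib real_norm_def mult_1 .
  qed
  also have "(\<lambda>n. ?c * (real n powr (-1/2) - (real n + 2) powr (-1/2))) \<in> O(\<lambda>n. real n powr (-3/2))"
    by real_asymp
  finally show ?thesis .
qed

section \<open>Decay of the sums at z other than 1 and -1\<close>

lemma a_nm_0_bigo: "(\<lambda>n. real (a_nm n 0) / 2 ^ n) \<in> O(\<lambda>n. real n powr (-3/2))"
proof -
  have "(\<lambda>n. real (a_nm n 0) / 2 ^ n) \<in> O(\<lambda>n. path_prob n / real n)"
  proof (rule bigoI[of _ 2], rule eventually_mono[OF eventually_gt_at_top[of 0]])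
    fix n :: nat assume n: "n > 0"
    show "norm (real (a_nm n 0) / 2 ^ n) \<le> 2 * norm (path_prob n / real n)"
    proof (cases "even n")
      case True
      then obtain k where k: "n = 2 * k" by (rule evenE)
      then have "real (a_nm n 0) / 2 ^ n = cb_ratio k / (real k + 1)" using a_nm_even_0_ratio by simp
      also have "\<dots> \<le> cb_ratio k / real k" using cb_ratio_pos[of k] n k by (intro divide_left_mono) auto
      also have "\<dots> = 2 * (path_prob n / real n)" using path_prob_cb_ratio[of k] k by simp
      finally show ?thesis using path_prob_pos[of n] by simp
    next
      case False
      then show ?thesis using a_nm_odd[of n 0] by simp
    qed
  qed
  also have "(\<lambda>n. path_prob n / real n) \<in> O(\<lambda>n. (sqrt (2 / pi) * real n powr (-1/2) + real n powr (-3/2)) / real n)"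
  proof (intro landau_o.big.divide_right)
    have "(\<lambda>n. path_prob n - sqrt (2 / pi) * real n powr (-1/2)) \<in> O(\<lambda>n. sqrt (2 / pi) * real n powr (-1/2) + real n powr (-3/2))"
      by (rule landau_o.big_trans[OF path_prob_asymptotic]) real_asymp
    moreover have "(\<lambda>n. sqrt (2 / pi) * real n powr (-1/2)) \<in> O(\<lambda>n. sqrt (2 / pi) * real n powr (-1/2) + real n powr (-3/2))"
      by real_asymp
    ultimately have "(\<lambda>n. (path_prob n - sqrt (2 / pi) * real n powr (-1/2)) + sqrt (2 / pi) * real n powr (-1/2)) \<in> O(\<lambda>n. sqrt (2 / pi) * real n powr (-1/2) + real n powr (-3/2))"
      by (rule sum_in_bigo)
    then show "path_prob \<in> O(\<lambda>n. sqrt (2 / pi) * real n powr (-1/2) + real n powr (-3/2))" by simp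
  qed (real_asymp | auto)+
  also have "(\<lambda>n. (sqrt (2 / pi) * real n powr (-1/2) + real n powr (-3/2)) / real n) \<in> O(\<lambda>n. real n powr (-3/2))"
    by real_asymp
  finally show ?thesis .
qed

text \<open>The forcing term t decays slower than geometrically, so it dominates the homogeneous solution.\<close>

lemma bigo_contraction:
  fixes s t g :: "nat \<Rightarrow> real"
  assumes rec: "\<And>n. \<bar>s (Suc n)\<bar> \<le> \<mu> * \<bar>s n\<bar> + \<bar>t n\<bar>"
    and \<mu>: "0 \<le> \<mu>" "\<mu> < 1" and t: "t \<in> O(g)"
    and g: "eventually (\<lambda>n. g n > 0) at_top" "(\<lambda>n. g n / g (Suc n)) \<longlonglongrightarrow> 1"
  shows "s \<in> O(g)"
proof -
  obtain D where D: "D > 0" "eventually (\<lambda>n. norm (t n) \<le> D * norm (g n)) at_top"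
    using t by (auto elim: landau_o.bigE)
  \<comment> \<open>Strictly between 1 and 1/\<mu>: it eventually bounds g n / g (n + 1), yet \<mu>
    * \<rho> < 1. For \<mu> = 0 any number above 1 serves.\<close>
  define \<rho> where "\<rho> = (if \<mu> = 0 then 2 else (1 + 1 / \<mu>) / 2)"
  have \<rho>: "\<rho> > 1" "\<mu> * \<rho> < 1" using \<mu> by (auto simp: \<rho>_def field_simps)
  have "eventually (\<lambda>n. g n / g (Suc n) < \<rho>) at_top" using order_tendstoD(2)[OF g(2) \<rho>(1)] .
  with D(2) g(1) have "eventually (\<lambda>n. norm (t n) \<le> D * norm (g n) \<and> g n > 0 \<and> g n / g (Suc n) < \<rho>) at_top"
    by eventually_elim simp
  then obtain N where N: "\<And>n. n \<ge> N \<Longrightarrow> \<bar>t n\<bar> \<le> D * \<bar>g n\<bar>" "\<And>n. n \<ge> N \<Longrightarrow> g n > 0"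
      "\<And>n. n \<ge> N \<Longrightarrow> g n / g (Suc n) < \<rho>"
    by (auto simp: eventually_at_top_linorder)
  \<comment> \<open>The second entry solves (\<mu> * K + D) * \<rho> = K, which makes the bound
    propagate; the first starts the induction at N.\<close>
  define K where "K = max (\<bar>s N\<bar> / g N) (D * \<rho> / (1 - \<mu> * \<rho>))"
  have K: "(\<mu> * K + D) * \<rho> \<le> K" "K \<ge> 0"
  proof -
    have "D * \<rho> / (1 - \<mu> * \<rho>) \<le> K" by (simp add: K_def)
    then show "(\<mu> * K + D) * \<rho> \<le> K" using \<rho> by (simp add: divide_le_eq algebra_simps)
    have "0 \<le> \<bar>s N\<bar> / g N" using N(2)[of N] by simp
    then show "K \<ge> 0" by (simp add: K_def)
  qed
  have "\<bar>s n\<bar> \<le> K * g n" if "n \<ge> N" for n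
    using that
  proof (induction n rule: dec_induct)
    case base
    have "\<bar>s N\<bar> / g N \<le> K" by (simp add: K_def)
    then show ?case using N(2)[of N] by (simp add: divide_le_eq)
  next
    case (step n)
    have gp: "g n > 0" "g (Suc n) > 0" using N(2) step.hyps by auto
    have "\<bar>s (Suc n)\<bar> \<le> \<mu> * (K * g n) + D * g n"
      using rec[of n] mult_left_mono[OF step.IH \<mu>(1)] N(1)[of n] step.hyps gp by simp
    also have "\<dots> = (\<mu> * K + D) * g n" by (simp add: algebra_simps)
    also have "\<dots> \<le> (\<mu> * K + D) * (\<rho> * g (Suc n))"
      using N(3)[of n] step.hyps gp K(2) \<mu> D(1) by (intro mult_left_mono) (auto simp: divide_less_eq)
    also have "\<dots> \<le> K * g (Suc n)"
      using mult_right_mono[OF K(1), of "g (Suc n)"] gp by (simp add: mult_ac)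
    finally show ?case .
  qed
  then have "eventually (\<lambda>n. norm (s n) \<le> K * norm (g n)) at_top"
    using N(2) by (intro eventually_at_top_linorderI[of N]) force
  then show ?thesis by (rule bigoI)
qed

text \<open>On the unit circle \<open>inverse z\<close> is the conjugate of z, so the contraction
  factor is the absolute value of Re z, which is below 1 away from 1 and -1.\<close>

lemma path_sum_bigo:
  assumes "norm z = 1" "z \<noteq> 1" "z \<noteq> - 1"
  shows "(\<lambda>n. norm (path_sum n z) / 2 ^ n) \<in> O(\<lambda>n. real n powr (-3/2))"
proof (rule bigo_contraction)
  have z0: "z \<noteq> 0" using assms by auto
  show "\<bar>norm (path_sum (Suc n) z) / 2 ^ Suc n\<bar> \<le> norm (z + inverse z) / 2 * \<bar>norm (path_sum n z) / 2 ^ n\<bar> +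
      \<bar>real (a_nm n 0) / 2 ^ n\<bar>" for n
  proof -
    have "norm (path_sum (Suc n) z) \<le> norm (z + inverse z) * norm (path_sum n z) + real (a_nm n 0)"
      unfolding path_sum_Suc[OF z0] by (metis norm_mult norm_of_nat norm_triangle_ineq4)
    \<comment> \<open>Doubling the forcing term lets it be divided by 2^n instead of
      2^(n+1).\<close>
    also have "\<dots> \<le> norm (z + inverse z) * norm (path_sum n z) + 2 * real (a_nm n 0)" by simp
    finally show ?thesis by (simp add: field_simps)
  qed
  have inv: "inverse z = cnj z"
    by (rule inverse_unique) (use complex_norm_square[of z] assms(1) in simp)
  have zz: "Re z ^ 2 + Im z ^ 2 = 1" using assms(1) cmod_power2[of z] by simp
  have "Im z \<noteq> 0"
  proof
    assume "Im z = 0"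
    with zz have "Re z = 1 \<or> Re z = -1" by (simp add: power2_eq_1_iff)
    with \<open>Im z = 0\<close> assms show False by (auto simp: complex_eq_iff)
  qed
  then have "Im z ^ 2 > 0" by simp
  with zz have "Re z ^ 2 < 1" by linarith
  then have "\<bar>Re z\<bar> < 1" by (simp add: abs_square_less_1)
  moreover have "z + inverse z = of_real (2 * Re z)" by (simp add: inv complex_add_cnj)
  ultimately show "norm (z + inverse z) / 2 < 1" by (simp only: norm_of_real)
  show "(\<lambda>n. real (a_nm n 0) / 2 ^ n) \<in> O(\<lambda>n. real n powr (-3/2))" by (rule a_nm_0_bigo)
  show "(\<lambda>n. real n powr (-3/2) / real (Suc n) powr (-3/2)) \<longlonglongrightarrow> 1" by real_asymp
  show "eventually (\<lambda>n. real n powr (-3/2) > 0) at_top" by real_asymp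
qed simp

section \<open>Fourier expansion modulo 2l\<close>

lemma cis_eq_1_iff_dvd:
  assumes "l > 0"
  shows "cis (pi * of_int d / real l) = 1 \<longleftrightarrow> 2 * int l dvd d"
proof
  assume "cis (pi * of_int d / real l) = 1"
  then have "cos (pi * of_int d / real l) = 1" by (simp add: complex_eq_iff)
  then obtain i :: int where "pi * of_int d / real l = of_int i * 2 * pi"
    by (auto simp: cos_one_2pi_int)
  then have "of_int d = (of_int (2 * int l * i) :: real)" using assms by (simp add: field_simps)
  then have "d = 2 * int l * i" by (simp only: of_int_eq_iff)
  then show "2 * int l dvd d" by simp
next
  assume "2 * int l dvd d"
  then obtain i where d: "d = 2 * int l * i" by (rule dvdE)
  have "pi * of_int d / real l = 2 * pi * of_int i" using assms by (simp add: d)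
  then show "cis (pi * of_int d / real l) = 1" by (simp add: cis_multiple_2pi)
qed

definition unit_root :: "nat \<Rightarrow> nat \<Rightarrow> complex" where
  "unit_root l k = cis (pi * real k / real l)"

text \<open>Orthogonality of characters: the summands are the powers of a single 2l-th root of unity
  w, and the geometric sum vanishes unless w = 1.\<close>

lemma character_sum:
  assumes "l > 0"
  shows "(\<Sum>k<2 * l. inverse (unit_root l k) ^ j * unit_root l k ^ M) =
    (if 2 * int l dvd int M - int j then of_nat (2 * l) else 0)"
proof -
  define d where "d = int M - int j"
  define w where "w = cis (pi * of_int d / real l)"
  have "inverse (unit_root l k) ^ j * unit_root l k ^ M = w ^ k" for k
    unfolding unit_root_def w_def cis_inverse Complex.DeMoivre cis_mult
    by (rule arg_cong[of _ _ cis]) (use assms in \<open>simp add: d_def field_simps\<close>)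
  then have *: "(\<Sum>k<2 * l. inverse (unit_root l k) ^ j * unit_root l k ^ M) = (\<Sum>k<2 * l. w ^ k)" by simp
  have "w ^ (2 * l) = 1"
  proof -
    have "real (2 * l) * (pi * of_int d / real l) = 2 * pi * of_int d" using assms by simp
    then show ?thesis unfolding w_def Complex.DeMoivre by (simp only: cis_multiple_2pi Ints_of_int)
  qed
  then have "w \<noteq> 1 \<Longrightarrow> (\<Sum>k<2 * l. w ^ k) = 0" by (simp add: geometric_sum)
  moreover have "w = 1 \<longleftrightarrow> 2 * int l dvd d"
    unfolding w_def by (rule cis_eq_1_iff_dvd[OF assms])
  ultimately show ?thesis unfolding * d_def[symmetric] by auto
qed

text \<open>Sums the orthogonality relation over the allowed residues j <= l; as l < 2l, at most one
  j agrees with M modulo 2l.\<close>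

lemma indicator_fourier:
  assumes "l > 0"
  shows "(\<Sum>k<2 * l. (\<Sum>j\<le>l. inverse (unit_root l k) ^ j) * unit_root l k ^ M) =
    (if M mod (2 * l) \<le> l then of_nat (2 * l) else 0)"
proof -
  have int_mod: "int i mod (2 * int l) = int (i mod (2 * l))" for i by (simp add: zmod_int)
  have dvd: "2 * int l dvd int M - int j \<longleftrightarrow> j = M mod (2 * l)" if "j \<le> l" for j
  proof -
    have "2 * int l dvd int M - int j \<longleftrightarrow> int M mod (2 * int l) = int j mod (2 * int l)"
      by (rule mod_eq_dvd_iff[symmetric])
    also have "\<dots> \<longleftrightarrow> M mod (2 * l) = j mod (2 * l)"
      unfolding int_mod by (rule of_nat_eq_iff)
    also have "j mod (2 * l) = j" using that assms by simp
    finally show ?thesis by auto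
  qed
  have "(\<Sum>k<2 * l. (\<Sum>j\<le>l. inverse (unit_root l k) ^ j) * unit_root l k ^ M) =
      (\<Sum>j\<le>l. \<Sum>k<2 * l. inverse (unit_root l k) ^ j * unit_root l k ^ M)"
    unfolding sum_distrib_right by (rule sum.swap)
  also have "\<dots> = (\<Sum>j\<le>l. if j = M mod (2 * l) then of_nat (2 * l) else 0)"
    by (intro sum.cong) (simp_all only: character_sum[OF assms] dvd atMost_iff)
  also have "\<dots> = (if M mod (2 * l) \<le> l then of_nat (2 * l) else 0)"
    by (subst sum.delta) auto
  finally show ?thesis .
qed

lemma b_n_fourier:
  assumes "l \<ge> 2"
  shows "complex_of_real (b_n l n) =
    (\<Sum>k<2 * l. (\<Sum>j\<le>l. inverse (unit_root l k) ^ j) * path_sum n (unit_root l k)) / of_nat (2 * l)"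
proof -
  have "(\<Sum>k<2 * l. (\<Sum>j\<le>l. inverse (unit_root l k) ^ j) * path_sum n (unit_root l k)) =
      (\<Sum>k<2 * l. \<Sum>m\<le>n. of_nat (a_nm n m) * ((\<Sum>j\<le>l. inverse (unit_root l k) ^ j) * unit_root l k ^ Suc m))"
    unfolding path_sum_def sum_distrib_left by (intro sum.cong refl) (simp only: mult_ac)
  also have "\<dots> = (\<Sum>m\<le>n. of_nat (a_nm n m) * (\<Sum>k<2 * l. (\<Sum>j\<le>l. inverse (unit_root l k) ^ j) * unit_root l k ^ Suc m))"
    unfolding sum_distrib_left[of "of_nat _"] by (rule sum.swap)
  also have "\<dots> = (\<Sum>m\<le>n. of_nat (2 * l) * of_real (if Suc m mod (2 * l) \<le> l then real (a_nm n m) else 0))"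
    using assms by (intro sum.cong refl) (simp add: indicator_fourier del: power_Suc)
  also have "\<dots> = of_nat (2 * l) * complex_of_real (b_n l n)"
    unfolding b_n_eq[OF assms] of_real_sum sum_distrib_left ..
  finally show ?thesis using assms by simp
qed

section \<open>Leading term and error estimate\<close>

text \<open>The combined weight of the characters 1 and -1: l + 1 comes from z = 1, and the sign,
  present only for even l, from z = -1 through \<open>path_sum_minus\<close>.\<close>

definition wall_density :: "nat \<Rightarrow> nat \<Rightarrow> real" where
  "wall_density l n = (real l + 1 + (if even l then (- 1) ^ Suc n else 0)) / (2 * real l)"

text \<open>The indices k = 0 and k = l, that is z = 1 and z = -1, give the main term exactly. The
  others form a sum of fixed length with every term O(n^(-3/2)).\<close>

lemma b_n_error:
  assumes "l \<ge> 2"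
  shows "(\<lambda>n. b_n l n / 2 ^ n - wall_density l n * path_prob n) \<in> O(\<lambda>n. real n powr (-3/2))"
proof -
  define c where "c k = (\<Sum>j\<le>l. inverse (unit_root l k) ^ j)" for k
  define I where "I = {..<2 * l} - {0, l}"
  have z0: "unit_root l 0 = 1" and zl: "unit_root l l = - 1" using assms by (simp_all add: unit_root_def)
  have c0: "c 0 = of_nat l + 1" by (simp add: c_def z0)
  \<comment> \<open>An alternating sum of l + 1 signs: the source of the dependence on the parity of
    l.\<close>
  have cl: "c l = (if even l then 1 else 0)"
  proof -
    have "(\<Sum>j\<le>m. (- 1 :: complex) ^ j) = (if even m then 1 else 0)" for m
      by (induction m) auto
    then show ?thesis by (simp add: c_def zl)
  qed
  have eq: "complex_of_real (b_n l n / 2 ^ n - wall_density l n * path_prob n) =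
      (\<Sum>k\<in>I. c k * path_sum n (unit_root l k)) / (of_nat (2 * l) * 2 ^ n)" for n
  proof -
    have "(\<Sum>k<2 * l. c k * path_sum n (unit_root l k)) = c 0 * path_sum n 1 + c l * path_sum n (- 1) + (\<Sum>k\<in>I. c k * path_sum n (unit_root l k))"
      unfolding I_def using assms by (subst sum.subset_diff[of "{0, l}"]) (auto simp: z0 zl)
    also have "c 0 * path_sum n 1 + c l * path_sum n (- 1) = of_nat (2 * l) * of_real (wall_density l n) * path_sum n 1"
      using assms by (simp add: c0 cl path_sum_minus[of n 1] wall_density_def field_simps)
    finally have "complex_of_real (b_n l n) * of_nat (2 * l) =
        of_nat (2 * l) * of_real (wall_density l n) * of_real (path_prob n * 2 ^ n) + (\<Sum>k\<in>I. c k * path_sum n (unit_root l k))"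
      unfolding path_sum_1[symmetric] b_n_fourier[OF assms] c_def[symmetric] using assms by simp
    moreover have "b_n l n = (b_n l n / 2 ^ n - wall_density l n * path_prob n) * 2 ^ n + wall_density l n * (path_prob n * 2 ^ n)"
      by (simp add: field_simps)
    then have "complex_of_real (b_n l n) =
        of_real (b_n l n / 2 ^ n - wall_density l n * path_prob n) * 2 ^ n + of_real (wall_density l n) * of_real (path_prob n * 2 ^ n)"
      by (metis of_real_add of_real_mult of_real_numeral of_real_power)
    \<comment> \<open>Eliminates \<open>b_n\<close> between the two identities, with D the error, P
      = 2^n, C the density and U the number of paths.\<close>
    moreover have "s = N * P * D" if "B * N = N * C * U + s" "B = D * P + C * U" for B C D N P U s :: complex
      using that by (simp add: algebra_simps)
    ultimately have "(\<Sum>k\<in>I. c k * path_sum n (unit_root l k)) = of_nat (2 * l) * 2 ^ n * of_real (b_n l n / 2 ^ n - wall_density l n * path_prob n)"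
      by blast
    then show ?thesis using assms by simp
  qed
  have sum: "(\<lambda>n. \<Sum>k\<in>I. norm (c k) / real (2 * l) * (norm (path_sum n (unit_root l k)) / 2 ^ n)) \<in> O(\<lambda>n. real n powr (-3/2))"
  proof (rule big_sum_in_bigo)
    fix k assume "k \<in> I"
    then have k: "0 < k" "k < 2 * l" "k \<noteq> l" by (auto simp: I_def)
    have "unit_root l k \<noteq> 1"
      using cis_eq_1_iff_dvd[of l "int k"] k zdvd_not_zless[of "int k" "2 * int l"] assms by (auto simp: unit_root_def)
    moreover have "unit_root l k \<noteq> - 1"
    proof
      assume "unit_root l k = - 1"
      \<comment> \<open>Multiplying by -1 shifts k by l, so 2l divides k + l. As k + l lies strictly
        between l and 3l, it equals 2l, contradicting k \<noteq> l.\<close>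
      then have "unit_root l k * cis pi = 1" by simp
      moreover have "unit_root l k * cis pi = cis (pi * of_int (int k + int l) / real l)"
        unfolding unit_root_def cis_mult using assms by (intro arg_cong[of _ _ cis]) (simp add: field_simps)
      ultimately have "cis (pi * of_int (int k + int l) / real l) = 1" by (simp only:)
      moreover have "l > 0" using assms by simp
      ultimately have "2 * int l dvd int k + int l" using cis_eq_1_iff_dvd[of l "int k + int l"] by blast
      then obtain i where i: "int k + int l = 2 * int l * i" by (rule dvdE)
      then have "int l * (2 * i) = int k + int l" by simp
      then have "int l * 1 < int l * (2 * i)" "int l * (2 * i) < int l * 3" using k by simp_all
      moreover have "0 < int l" using assms by simp
      ultimately have "1 < 2 * i" "2 * i < 3" by (simp_all only: mult_less_cancel_left_pos)
      then have "i = 1" by simp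
      with i k show False by simp
    qed
    moreover have "norm (unit_root l k) = 1" by (simp add: unit_root_def)
    ultimately have "(\<lambda>n. norm (path_sum n (unit_root l k)) / 2 ^ n) \<in> O(\<lambda>n. real n powr (-3/2))"
      by (intro path_sum_bigo)
    then show "(\<lambda>n. norm (c k) / real (2 * l) * (norm (path_sum n (unit_root l k)) / 2 ^ n)) \<in> O(\<lambda>n. real n powr (-3/2))"
      using assms by (cases "c k = 0") (simp, subst landau_o.big.cmult_in_iff, simp_all only:, simp)
  qed
  have bound: "norm (b_n l n / 2 ^ n - wall_density l n * path_prob n) \<le>
      1 * norm (\<Sum>k\<in>I. norm (c k) / real (2 * l) * (norm (path_sum n (unit_root l k)) / 2 ^ n))" for n
  proof -
    have "norm (b_n l n / 2 ^ n - wall_density l n * path_prob n) = norm (complex_of_real (b_n l n / 2 ^ n - wall_density l n * path_prob n))"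
      by (simp only: norm_of_real real_norm_def)
    also have "\<dots> = norm (\<Sum>k\<in>I. c k * path_sum n (unit_root l k)) / (real (2 * l) * 2 ^ n)"
      unfolding eq by (simp add: norm_divide norm_mult norm_power)
    also have "\<dots> \<le> (\<Sum>k\<in>I. norm (c k * path_sum n (unit_root l k))) / (real (2 * l) * 2 ^ n)"
      by (intro divide_right_mono norm_sum) simp
    also have "\<dots> = (\<Sum>k\<in>I. norm (c k) / real (2 * l) * (norm (path_sum n (unit_root l k)) / 2 ^ n))"
      by (simp add: sum_divide_distrib norm_mult)
    finally show ?thesis by simp
  qed
  show ?thesis
    by (rule landau_o.big_trans[OF bigoI[OF always_eventually[OF allI[OF bound]]] sum])
qed

lemma b_asym_eq: "b_asym l n = wall_density l n * a_asym n"
  by (simp add: b_asym_def wall_density_def)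

text \<open>The upper bound keeps errors small under multiplication by the density; the lower bound
  keeps the oscillating main term comparable to n^(-1/2) * 2^n.\<close>

lemma wall_density_bounds:
  assumes "l \<ge> 2"
  shows "1 / 2 \<le> wall_density l n" "wall_density l n \<le> 1"
proof -
  have "(- 1 :: real) ^ Suc n \<in> {-1, 1}" by (cases "even n") auto
  then have "real l \<le> real l + 1 + (if even l then (- 1) ^ Suc n else 0)"
    "real l + 1 + (if even l then (- 1) ^ Suc n else 0) \<le> 2 * real l"
    using assms by auto
  then show "1 / 2 \<le> wall_density l n" "wall_density l n \<le> 1"
    unfolding wall_density_def using assms by (simp_all add: pos_le_divide_eq pos_divide_le_eq)
qed

lemma b_n_asymptotic:
  assumes "l \<ge> 2"
  shows "(\<lambda>n. (b_n l n - b_asym l n) / 2 ^ n) \<in> O(\<lambda>n. real n powr (-3/2))"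
proof -
  have "(\<lambda>n. wall_density l n * (path_prob n - sqrt (2 / pi) * real n powr (-1/2))) \<in> O(\<lambda>n. path_prob n - sqrt (2 / pi) * real n powr (-1/2))"
  proof (intro bigoI[of _ 1] always_eventually allI)
    fix n
    have "\<bar>wall_density l n\<bar> \<le> 1" using wall_density_bounds[OF assms, of n] by linarith
    then show "norm (wall_density l n * (path_prob n - sqrt (2 / pi) * real n powr (-1/2))) \<le>
        1 * norm (path_prob n - sqrt (2 / pi) * real n powr (-1/2))"
      unfolding norm_mult real_norm_def abs_mult by (rule mult_right_mono) simp
  qed
  also note path_prob_asymptotic
  finally have "(\<lambda>n. (b_n l n / 2 ^ n - wall_density l n * path_prob n) + wall_density l n * (path_prob n - sqrt (2 / pi) * real n powr (-1/2)))
      \<in> O(\<lambda>n. real n powr (-3/2))"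
    by (rule sum_in_bigo(1)[OF b_n_error[OF assms]])
  also have "(\<lambda>n. (b_n l n / 2 ^ n - wall_density l n * path_prob n) + wall_density l n * (path_prob n - sqrt (2 / pi) * real n powr (-1/2))) =
      (\<lambda>n. (b_n l n - b_asym l n) / 2 ^ n)"
    by (simp add: fun_eq_iff b_asym_eq a_asym_def field_simps)
  finally show ?thesis .
qed

theorem theorem2p12:
  fixes l :: nat
  assumes "l \<ge> 2"
  shows "(\<lambda>n. b_n l n) \<sim>[at_top] (\<lambda>n. b_asym l n) \<and>
         (\<lambda>n. \<bar>b_n l n - b_asym l n\<bar> / (real n powr (-1/2) * 2 ^ n))
           \<in> O(\<lambda>n. 1 / real n)"
proof
  let ?d = "\<lambda>n. (b_n l n - b_asym l n) / 2 ^ n"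
  \<comment> \<open>Needed to turn the absolute error into a relative one; the constant comes from
    the density being at least 1/2.\<close>
  have "(\<lambda>n. real n powr (-1/2)) \<in> O(\<lambda>n. b_asym l n / 2 ^ n)"
  proof (rule bigoI[of _ "2 / sqrt (2 / pi)"], rule always_eventually, rule allI)
    fix n
    have "real n powr (-1/2) * (1 / 2) \<le> real n powr (-1/2) * wall_density l n"
      by (intro mult_left_mono wall_density_bounds assms) simp
    then show "norm (real n powr (-1/2)) \<le> 2 / sqrt (2 / pi) * norm (b_asym l n / 2 ^ n)"
      using wall_density_bounds(1)[OF assms, of n] by (simp add: b_asym_eq a_asym_def abs_mult mult_ac)
  qed
  moreover have "?d \<in> o(\<lambda>n. real n powr (-1/2))"
    by (rule landau_o.big_small_trans[OF b_n_asymptotic[OF assms]]) real_asymp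
  ultimately have "?d \<in> o(\<lambda>n. b_asym l n / 2 ^ n)"
    by (rule landau_o.small_big_trans[rotated])
  then have "(\<lambda>n. b_n l n - b_asym l n) \<in> o(b_asym l)"
    by (simp add: landau_o.small.divide_right_iff)
  then show "b_n l \<sim>[at_top] b_asym l" by (rule smallo_imp_asymp_equiv)
  have "(\<lambda>n. ?d n / real n powr (-1/2)) \<in> O(\<lambda>n. real n powr (-3/2) / real n powr (-1/2))"
    by (intro landau_o.big.divide_right b_n_asymptotic assms eventually_mono[OF eventually_gt_at_top[of 0]]) auto
  also have "(\<lambda>n. real n powr (-3/2) / real n powr (-1/2)) \<in> O(\<lambda>n. 1 / real n)" by real_asymp
  finally have "(\<lambda>n. \<bar>?d n / real n powr (-1/2)\<bar>) \<in> O(\<lambda>n. 1 / real n)"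
    by (simp only: landau_o.big.abs_in_iff)
  also have "(\<lambda>n. \<bar>?d n / real n powr (-1/2)\<bar>) = (\<lambda>n. \<bar>b_n l n - b_asym l n\<bar> / (real n powr (-1/2) * 2 ^ n))"
    by (simp add: fun_eq_iff abs_divide mult.commute)
  finally show "(\<lambda>n. \<bar>b_n l n - b_asym l n\<bar> / (real n powr (-1/2) * 2 ^ n)) \<in> O(\<lambda>n. 1 / real n)" .
qed

end
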